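(* Let $(\Omega,\mathcal{F},\mu)$ be a $\sigma$-finite measure space, let $1<p<\infty$, let $p'$ be the conjugate exponent of $p$, and let $T$ be a uniformly eventually positive, Cesàro bounded operator on $L^p(\Omega)=L^p(\Omega,\mu)$. Then, as $n\to\infty$, $$\|T^n\|=\mathcal{O}\left(\frac{n}{\log(n)^{\max\{1/p,\,1/p'\}}}\right).$$
   Context: $L^p(\Omega)$ is the complex Lebesgue space with its usual order; $1/p+1/p'=1$. A bounded operator $S$ on $L^p(\Omega)$ is positive if $Sx\ge0$ whenever $x\ge0$. A bounded operator $T$ is uniformly eventually positive if there exists $n_0\in\mathbb{N}$ such that $T^n$ is a positive operator for every $n\ge n_0$. A bounded operator $T$ on a Banach space is Cesàro bounded if $$\sup_{n\ge1}\frac1n\left\|\sum_{k=0}^{n-1}T^k\right\|<+\infty.$$ *)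

theory Defs
  imports "HOL-Analysis.Analysis" "HOL-Library.Landau_Symbols"
begin

text \<open>
  Elements of \<open>L\<^sup>p\<close> are represented by measurable complex functions, and equality in \<open>L\<^sup>p\<close> by
  equality almost everywhere. Correspondingly, an operator on \<open>L\<^sup>p\<close> is represented by a map on
  functions that respects almost-everywhere equality on \<open>L\<^sup>p\<close>; its values on functions
  outside \<open>L\<^sup>p\<close> are irrelevant. Every operator on the quotient space arises in this way, and
  powers and sums of operators are represented by iterates and pointwise sums of their
  representatives.
\<close>

definition Lp_space :: "real \<Rightarrow> 'a measure \<Rightarrow> ('a \<Rightarrow> complex) set" where
  "Lp_space p M = {f \<in> borel_measurable M. integrable M (\<lambda>x. cmod (f x) powr p)}"

definition Lp_norm :: "real \<Rightarrow> 'a measure \<Rightarrow> ('a \<Rightarrow> complex) \<Rightarrow> real" where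
  "Lp_norm p M f = (\<integral>x. cmod (f x) powr p \<partial>M) powr (1 / p)"

definition Lp_bounded_operator ::
    "real \<Rightarrow> 'a measure \<Rightarrow> (('a \<Rightarrow> complex) \<Rightarrow> ('a \<Rightarrow> complex)) \<Rightarrow> bool" where
  "Lp_bounded_operator p M T \<longleftrightarrow>
     (\<forall>f \<in> Lp_space p M. T f \<in> Lp_space p M) \<and>
     (\<forall>f \<in> Lp_space p M. \<forall>g \<in> Lp_space p M.
        (AE x in M. f x = g x) \<longrightarrow> (AE x in M. T f x = T g x)) \<and>
     (\<forall>f \<in> Lp_space p M. \<forall>g \<in> Lp_space p M. AE x in M. T (\<lambda>y. f y + g y) x = T f x + T g x) \<and>
     (\<forall>f \<in> Lp_space p M. \<forall>c. AE x in M. T (\<lambda>y. c * f y) x = c * T f x) \<and>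
     (\<exists>C. \<forall>f \<in> Lp_space p M. Lp_norm p M (T f) \<le> C * Lp_norm p M f)"

definition Lp_opnorm ::
    "real \<Rightarrow> 'a measure \<Rightarrow> (('a \<Rightarrow> complex) \<Rightarrow> ('a \<Rightarrow> complex)) \<Rightarrow> real" where
  "Lp_opnorm p M T = (SUP f \<in> {f \<in> Lp_space p M. Lp_norm p M f \<le> 1}. Lp_norm p M (T f))"

text \<open>
  In the usual order of the complex space \<open>L\<^sup>p\<close>, a function is \<open>\<ge> 0\<close> iff almost all of its
  values are real and nonnegative.
\<close>

definition Lp_positive ::
    "real \<Rightarrow> 'a measure \<Rightarrow> (('a \<Rightarrow> complex) \<Rightarrow> ('a \<Rightarrow> complex)) \<Rightarrow> bool" where
  "Lp_positive p M S \<longleftrightarrow>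
     (\<forall>f \<in> Lp_space p M. (AE x in M. f x \<in> \<real>\<^sub>\<ge>\<^sub>0) \<longrightarrow> (AE x in M. S f x \<in> \<real>\<^sub>\<ge>\<^sub>0))"

definition Lp_uniformly_eventually_positive ::
    "real \<Rightarrow> 'a measure \<Rightarrow> (('a \<Rightarrow> complex) \<Rightarrow> ('a \<Rightarrow> complex)) \<Rightarrow> bool" where
  "Lp_uniformly_eventually_positive p M T \<longleftrightarrow> (\<exists>n\<^sub>0. \<forall>n\<ge>n\<^sub>0. Lp_positive p M (T ^^ n))"

definition Lp_Cesaro_bounded ::
    "real \<Rightarrow> 'a measure \<Rightarrow> (('a \<Rightarrow> complex) \<Rightarrow> ('a \<Rightarrow> complex)) \<Rightarrow> bool" where
  "Lp_Cesaro_bounded p M T \<longleftrightarrow>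
     bdd_above ((\<lambda>n. 1 / real n * Lp_opnorm p M (\<lambda>f x. \<Sum>k<n. (T ^^ k) f x)) ` {1..})"

end

theory Submission
  imports Defs
begin

text \<open>
  Let \<open>f \<ge> 0\<close> and write \<open>N f = \<parallel>f\<parallel>\<^sup>p\<close>. For large \<open>k\<close> all \<open>T\<^sup>k f\<close> are nonnegative, and since
  \<open>\<Sum> N f\<^sub>k \<le> N (\<Sum> f\<^sub>k)\<close> for nonnegative functions, Cesaro boundedness gives
  \<open>\<Sum>\<^sub>k N (T\<^sup>k f) \<le> (C m)\<^sup>p N f\<close>, the sum being over large \<open>k < m\<close>. Dually,
  \<open>N (\<Sum>\<^sub>k T\<^sup>k f\<^sub>k) \<le> (C m)\<^sup>p \<Sum>\<^sub>k N f\<^sub>k\<close> for nonnegative \<open>f\<^sub>k\<close>, because all \<open>f\<^sub>k\<close> lie below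
  \<open>(\<Sum>\<^sub>k f\<^sub>k\<^sup>p)\<^bsup>1/p\<^esup>\<close>. Now write \<open>T\<^sup>n f\<close> as \<open>T\<^sup>k (T\<^bsup>n-k\<^esup> f)\<close> or as \<open>T\<^bsup>n-k\<^esup> (T\<^sup>k f)\<close>, sum over about \<open>log n\<close> dyadic
  blocks of \<open>k\<close> with weights of size \<open>1/k\<close>, and use the dual estimate followed by the direct one.
  The two ways of writing \<open>T\<^sup>n f\<close> give the exponents \<open>1/p\<close> and \<open>1/p'\<close>.
\<close>

section \<open>Elementary inequalities for powers and finite sums\<close>

lemma sum_powr_le_powr_sum:
  fixes x :: "'i \<Rightarrow> real"
  assumes "1 \<le> p" "finite I" "\<And>i. i \<in> I \<Longrightarrow> 0 \<le> x i"
  shows "(\<Sum>i\<in>I. x i powr p) \<le> (\<Sum>i\<in>I. x i) powr p"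
proof -
  have split: "y powr p = y * y powr (p - 1)" if "0 \<le> y" for y :: real
    using that powr_add[of y 1 "p - 1"] by simp
  \<comment> \<open>Only the factor with exponent \<open>p - 1\<close> is enlarged to the total; the
    remaining linear factors then add up to one more factor of the total.\<close>
  have "x i powr p \<le> x i * (\<Sum>i\<in>I. x i) powr (p - 1)" if "i \<in> I" for i
    unfolding split[OF assms(3)[OF that]]
    using assms that by (intro mult_left_mono powr_mono2 member_le_sum) auto
  then have "(\<Sum>i\<in>I. x i powr p) \<le> (\<Sum>i\<in>I. x i) * (\<Sum>i\<in>I. x i) powr (p - 1)"
    unfolding sum_distrib_right by (rule sum_mono)
  also have "\<dots> = (\<Sum>i\<in>I. x i) powr p"
    using assms by (intro split[symmetric] sum_nonneg)
  finally show ?thesis .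
qed

text \<open>Each term is at most the maximum, and the maximum is one of the terms. The factor is
  cruder than the convexity constant, but it enters only through multiplicative constants.\<close>

lemma powr_sum_le:
  fixes x :: "'i \<Rightarrow> real"
  assumes "1 \<le> p" "finite I" "\<And>i. i \<in> I \<Longrightarrow> 0 \<le> x i"
  shows "(\<Sum>i\<in>I. x i) powr p \<le> real (card I) powr p * (\<Sum>i\<in>I. x i powr p)"
proof (cases "I = {}")
  case False
  let ?m = "Max (x ` I)"
  have "?m \<in> x ` I"
    using False assms by (intro Max_in) auto
  then obtain i where i: "i \<in> I" "x i = ?m"
    by force
  have "(\<Sum>i\<in>I. x i) \<le> real (card I) * x i"
    using assms i by (intro sum_bounded_above) auto
  then have "(\<Sum>i\<in>I. x i) powr p \<le> real (card I) powr p * x i powr p"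
    using assms i by (simp add: powr_mono2 sum_nonneg flip: powr_mult)
  also have "\<dots> \<le> real (card I) powr p * (\<Sum>i\<in>I. x i powr p)"
    using assms i by (intro mult_left_mono member_le_sum) auto
  finally show ?thesis .
qed simp

lemma of_real_cmod_nonneg_Reals: "z \<in> \<real>\<^sub>\<ge>\<^sub>0 \<Longrightarrow> complex_of_real (cmod z) = z"
  by (auto elim: nonneg_Reals_cases)

lemma cmod_sum_nonneg_Reals:
  assumes "\<And>i. i \<in> I \<Longrightarrow> f i \<in> \<real>\<^sub>\<ge>\<^sub>0"
  shows "cmod (\<Sum>i\<in>I. f i) = (\<Sum>i\<in>I. cmod (f i))"
proof -
  have "(\<Sum>i\<in>I. f i) = complex_of_real (\<Sum>i\<in>I. cmod (f i))"
    using assms by (simp add: of_real_cmod_nonneg_Reals)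
  then have "cmod (\<Sum>i\<in>I. f i) = \<bar>\<Sum>i\<in>I. cmod (f i)\<bar>"
    by (simp only: norm_of_real)
  then show ?thesis
    by (simp add: sum_nonneg)
qed

lemma sum_dyadic_blocks:
  fixes f :: "nat \<Rightarrow> real"
  assumes "a \<le> b"
  shows "(\<Sum>k=2^a..<2^b. f k) = (\<Sum>j=a..<b. \<Sum>k=2^j..<2^Suc j. f k)"
  using assms
proof (induction b rule: dec_induct)
  case (step m)
  have "(\<Sum>k=2^a..<2^Suc m. f k) = (\<Sum>k=2^a..<2^m. f k) + (\<Sum>k=2^m..<2^Suc m. f k)"
    using step.hyps by (intro sum.atLeastLessThan_concat[symmetric]) (auto intro: power_increasing)
  then show ?case
    using step by simp
qed simp

subsection \<open>The space of \<open>p\<close>-integrable functions\<close>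

text \<open>The p-th power of the norm. The estimates for sums take place at this level, where
  integration is additive; the triangle inequality is replaced by the cruder
  \<open>Lp_int_sum_le\<close>.\<close>

definition Lp_int :: "real \<Rightarrow> 'a measure \<Rightarrow> ('a \<Rightarrow> complex) \<Rightarrow> real" where
  "Lp_int p M f = (\<integral>x. cmod (f x) powr p \<partial>M)"

lemma Lp_int_nonneg: "0 \<le> Lp_int p M f"
  by (simp add: Lp_int_def)

lemma Lp_norm_nonneg: "0 \<le> Lp_norm p M f"
  by (simp add: Lp_norm_def)

lemma Lp_norm_zero: "Lp_norm p M (\<lambda>x. 0) = 0"
  by (simp add: Lp_norm_def)

lemma Lp_norm_eq: "Lp_norm p M f = Lp_int p M f powr (1 / p)"
  by (simp add: Lp_norm_def Lp_int_def)

lemma Lp_int_eq: "p > 0 \<Longrightarrow> Lp_int p M f = Lp_norm p M f powr p"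
  by (simp add: Lp_norm_eq powr_powr Lp_int_nonneg)

text \<open>The dictionary between norms and their p-th powers, by strict monotonicity of
  \<open>t powr p\<close> for \<open>t \<ge> 0\<close>.\<close>

lemma Lp_int_le_iff:
  assumes "p > 0" "0 \<le> D"
  shows "Lp_int p M f \<le> D powr p * Lp_int p M g \<longleftrightarrow> Lp_norm p M f \<le> D * Lp_norm p M g"
proof -
  have eq: "D powr p * Lp_int p M g = (D * Lp_norm p M g) powr p"
    using assms by (simp add: Lp_int_eq powr_mult Lp_norm_nonneg)
  have "0 \<le> D * Lp_norm p M g"
    using assms by (simp add: Lp_norm_nonneg)
  then show ?thesis
    unfolding eq unfolding Lp_int_eq[OF assms(1)]
    using powr_mono2[of p "Lp_norm p M f"] powr_less_mono2[of p "D * Lp_norm p M g"] assms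
    by (meson Lp_norm_nonneg less_imp_le linorder_not_less)
qed

lemma Lp_int_cong_AE:
  assumes "f \<in> Lp_space p M" "g \<in> Lp_space p M" "AE x in M. cmod (f x) = cmod (g x)"
  shows "Lp_int p M f = Lp_int p M g"
  using assms unfolding Lp_int_def Lp_space_def by (intro integral_cong_AE) auto

lemma Lp_int_mono:
  assumes "p > 0" "f \<in> Lp_space p M" "g \<in> Lp_space p M" "AE x in M. cmod (f x) \<le> cmod (g x)"
  shows "Lp_int p M f \<le> Lp_int p M g"
  using assms unfolding Lp_int_def Lp_space_def
  by (intro integral_mono_AE) (auto intro!: powr_mono2)

lemma Lp_int_scale: "Lp_int p M (\<lambda>x. c * f x) = cmod c powr p * Lp_int p M f"
  by (simp add: Lp_int_def norm_mult powr_mult)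

lemma Lp_space_dominated:
  assumes "p > 0" "g \<in> Lp_space p M" "f \<in> borel_measurable M" "AE x in M. cmod (f x) \<le> cmod (g x)"
  shows "f \<in> Lp_space p M"
proof -
  have "integrable M (\<lambda>x. cmod (f x) powr p)"
    by (rule Bochner_Integration.integrable_bound[where f = "\<lambda>x. cmod (g x) powr p"])
      (use assms in \<open>auto simp: Lp_space_def intro!: powr_mono2\<close>)
  then show ?thesis
    using assms by (simp add: Lp_space_def)
qed

lemma Lp_space_scale: "f \<in> Lp_space p M \<Longrightarrow> (\<lambda>x. c * f x) \<in> Lp_space p M"
  by (auto simp: Lp_space_def norm_mult powr_mult)

lemma Lp_space_minus: "f \<in> Lp_space p M \<Longrightarrow> (\<lambda>x. - f x) \<in> Lp_space p M"
  by (simp add: Lp_space_def)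

lemma Lp_space_zero: "(\<lambda>x. 0) \<in> Lp_space p M"
  by (simp add: Lp_space_def)

text \<open>Pointwise, \<open>powr_sum_le\<close> supplies one integrable majorant that yields both
  membership and the bound.\<close>

lemma
  assumes "1 \<le> p" "finite I" "\<And>i. i \<in> I \<Longrightarrow> f i \<in> Lp_space p M"
  shows Lp_space_sum: "(\<lambda>x. \<Sum>i\<in>I. f i x) \<in> Lp_space p M"
    and Lp_int_sum_le: "Lp_int p M (\<lambda>x. \<Sum>i\<in>I. f i x) \<le> real (card I) powr p * (\<Sum>i\<in>I. Lp_int p M (f i))"
proof -
  let ?g = "\<lambda>x. real (card I) powr p * (\<Sum>i\<in>I. cmod (f i x) powr p)"
  have le: "cmod (\<Sum>i\<in>I. f i x) powr p \<le> ?g x" for x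
  proof -
    have "cmod (\<Sum>i\<in>I. f i x) powr p \<le> (\<Sum>i\<in>I. cmod (f i x)) powr p"
      using assms by (intro powr_mono2 norm_sum) auto
    also have "\<dots> \<le> ?g x"
      using assms by (intro powr_sum_le) auto
    finally show ?thesis .
  qed
  have meas: "(\<lambda>x. \<Sum>i\<in>I. f i x) \<in> borel_measurable M"
    using assms by (intro borel_measurable_sum) (auto simp: Lp_space_def)
  have int: "integrable M ?g"
    using assms by (auto simp: Lp_space_def)
  have int': "integrable M (\<lambda>x. cmod (\<Sum>i\<in>I. f i x) powr p)"
    using meas le by (intro Bochner_Integration.integrable_bound[OF int])
      (auto simp: sum_nonneg)
  then show "(\<lambda>x. \<Sum>i\<in>I. f i x) \<in> Lp_space p M"
    using meas by (simp add: Lp_space_def)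
  have "Lp_int p M (\<lambda>x. \<Sum>i\<in>I. f i x) \<le> (\<integral>x. ?g x \<partial>M)"
    unfolding Lp_int_def using int int' le by (intro integral_mono) auto
  also have "\<dots> = real (card I) powr p * (\<Sum>i\<in>I. Lp_int p M (f i))"
    using assms by (simp add: Lp_int_def Lp_space_def)
  finally show "Lp_int p M (\<lambda>x. \<Sum>i\<in>I. f i x) \<le> real (card I) powr p * (\<Sum>i\<in>I. Lp_int p M (f i))" .
qed

lemma Lp_space_add:
  assumes "1 \<le> p" "f \<in> Lp_space p M" "g \<in> Lp_space p M"
  shows "(\<lambda>x. f x + g x) \<in> Lp_space p M"
  using Lp_space_sum[of p "UNIV :: bool set" "\<lambda>b. if b then f else g" M] assms
  by (simp add: UNIV_bool add.commute)

text \<open>Nonnegative summands cannot cancel, so almost everywhere the modulus of the sum is the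
  sum of the moduli, and \<open>sum_powr_le_powr_sum\<close> can be integrated.\<close>

lemma Lp_int_sum_ge:
  assumes "1 \<le> p" "finite I" "\<And>i. i \<in> I \<Longrightarrow> f i \<in> Lp_space p M"
    and "\<And>i. i \<in> I \<Longrightarrow> AE x in M. f i x \<in> \<real>\<^sub>\<ge>\<^sub>0"
  shows "(\<Sum>i\<in>I. Lp_int p M (f i)) \<le> Lp_int p M (\<lambda>x. \<Sum>i\<in>I. f i x)"
proof -
  have "AE x in M. \<forall>i\<in>I. f i x \<in> \<real>\<^sub>\<ge>\<^sub>0"
    using assms by (intro AE_finite_allI) auto
  then have "AE x in M. (\<Sum>i\<in>I. cmod (f i x) powr p) \<le> cmod (\<Sum>i\<in>I. f i x) powr p"
    by eventually_elim (use assms in \<open>simp add: cmod_sum_nonneg_Reals sum_powr_le_powr_sum\<close>)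
  moreover have "(\<Sum>i\<in>I. Lp_int p M (f i)) = (\<integral>x. (\<Sum>i\<in>I. cmod (f i x) powr p) \<partial>M)"
    using assms by (simp add: Lp_int_def Lp_space_def)
  moreover have "integrable M (\<lambda>x. \<Sum>i\<in>I. cmod (f i x) powr p)"
    using assms by (auto simp: Lp_space_def)
  ultimately show ?thesis
    using Lp_space_sum[OF assms(1-3)] unfolding Lp_int_def[of p M "\<lambda>x. \<Sum>i\<in>I. f i x"]
    by (simp add: Lp_space_def integral_mono_AE)
qed

subsection \<open>Operators\<close>

context
  fixes p :: real and M :: "'a measure" and S :: "('a \<Rightarrow> complex) \<Rightarrow> ('a \<Rightarrow> complex)"
  assumes S: "Lp_bounded_operator p M S"
begin

lemma Lp_operator_closed: "f \<in> Lp_space p M \<Longrightarrow> S f \<in> Lp_space p M"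
  using S by (simp add: Lp_bounded_operator_def)

lemma Lp_operator_cong:
  "f \<in> Lp_space p M \<Longrightarrow> g \<in> Lp_space p M \<Longrightarrow> AE x in M. f x = g x \<Longrightarrow> AE x in M. S f x = S g x"
  using S by (simp add: Lp_bounded_operator_def)

lemma Lp_operator_add:
  "f \<in> Lp_space p M \<Longrightarrow> g \<in> Lp_space p M \<Longrightarrow> AE x in M. S (\<lambda>y. f y + g y) x = S f x + S g x"
  using S by (simp add: Lp_bounded_operator_def)

lemma Lp_operator_scale:
  "f \<in> Lp_space p M \<Longrightarrow> AE x in M. S (\<lambda>y. c * f y) x = c * S f x"
  using S by (simp add: Lp_bounded_operator_def)

lemma Lp_operator_bound:
  obtains C where "C \<ge> 0" "\<And>f. f \<in> Lp_space p M \<Longrightarrow> Lp_norm p M (S f) \<le> C * Lp_norm p M f"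
proof -
  obtain C where C: "\<And>f. f \<in> Lp_space p M \<Longrightarrow> Lp_norm p M (S f) \<le> C * Lp_norm p M f"
    using S unfolding Lp_bounded_operator_def by blast
  have "Lp_norm p M (S f) \<le> \<bar>C\<bar> * Lp_norm p M f" if "f \<in> Lp_space p M" for f
    using C[OF that] mult_right_mono[OF abs_ge_self Lp_norm_nonneg, of C p M f] by linarith
  then show ?thesis
    using that[of "\<bar>C\<bar>"] by auto
qed

text \<open>The supremum in \<open>Lp_opnorm\<close> is taken in the reals, so it is an upper bound
  of the values only once boundedness is known.\<close>

lemma Lp_opnorm_bdd_above:
  "bdd_above ((\<lambda>f. Lp_norm p M (S f)) ` {f \<in> Lp_space p M. Lp_norm p M f \<le> 1})"
proof -
  obtain C where "C \<ge> 0" "\<And>f. f \<in> Lp_space p M \<Longrightarrow> Lp_norm p M (S f) \<le> C * Lp_norm p M f"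
    by (fact Lp_operator_bound)
  then have "Lp_norm p M (S f) \<le> C" if "f \<in> Lp_space p M" "Lp_norm p M f \<le> 1" for f
    using that by (smt (verit) mult_left_le)
  then show ?thesis
    by (auto intro!: bdd_aboveI)
qed

lemma Lp_opnorm_nonneg: "0 \<le> Lp_opnorm p M S"
  unfolding Lp_opnorm_def
  by (rule cSUP_upper2[OF Lp_opnorm_bdd_above, of "\<lambda>x. 0"])
    (auto simp: Lp_norm_nonneg Lp_space_zero Lp_norm_zero)

lemma Lp_opnorm_le:
  assumes "0 \<le> D" "\<And>f. f \<in> Lp_space p M \<Longrightarrow> Lp_norm p M (S f) \<le> D * Lp_norm p M f"
  shows "Lp_opnorm p M S \<le> D"
  unfolding Lp_opnorm_def
proof (rule cSUP_least)
  show "{f \<in> Lp_space p M. Lp_norm p M f \<le> 1} \<noteq> {}"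
    using Lp_space_zero Lp_norm_zero by (metis (mono_tags) empty_Collect_eq zero_le_one)
  show "Lp_norm p M (S f) \<le> D" if "f \<in> {f \<in> Lp_space p M. Lp_norm p M f \<le> 1}" for f
    using assms(2)[of f] that mult_left_le[of "Lp_norm p M f" D] assms(1) by auto
qed

text \<open>A function of norm \<open>r > 0\<close> is scaled by \<open>1/r\<close> into the unit
  ball. For norm 0 this is impossible, and the bound from the definition of boundedness gives 0
  directly.\<close>

lemma Lp_norm_operator_le:
  assumes "p > 0" "f \<in> Lp_space p M"
  shows "Lp_norm p M (S f) \<le> Lp_opnorm p M S * Lp_norm p M f"
proof (cases "Lp_norm p M f = 0")
  case True
  then show ?thesis
    using Lp_operator_bound assms(2) by (metis mult_zero_right)
next
  case False
  define r where "r = Lp_norm p M f"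
  have "r > 0"
    using False Lp_norm_nonneg[of p M f] by (simp add: r_def)
  have scale: "Lp_norm p M (\<lambda>x. complex_of_real c * g x) = c * Lp_norm p M g" if "c \<ge> 0" for c g
    using that assms(1) by (simp add: Lp_norm_eq Lp_int_scale powr_mult powr_powr)
  have "f \<in> Lp_space p M \<Longrightarrow> Lp_norm p M (S (\<lambda>x. complex_of_real (1/r) * f x)) \<le> Lp_opnorm p M S"
    unfolding Lp_opnorm_def using \<open>r > 0\<close> scale[of "1/r" f] Lp_space_scale[of f p M "complex_of_real (1/r)"]
    by (intro cSUP_upper[OF _ Lp_opnorm_bdd_above]) (auto simp: r_def)
  moreover have "Lp_norm p M (S (\<lambda>x. complex_of_real (1/r) * f x))
      = Lp_norm p M (\<lambda>x. complex_of_real (1/r) * S f x)"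
    unfolding Lp_norm_eq using assms Lp_operator_scale[of f "complex_of_real (1/r)"]
    by (intro arg_cong[where f = "\<lambda>t. t powr _"] Lp_int_cong_AE Lp_operator_closed Lp_space_scale)
      (auto elim: eventually_mono)
  ultimately have "1/r * Lp_norm p M (S f) \<le> Lp_opnorm p M S"
    using assms \<open>r > 0\<close> scale[of "1/r" "S f"] by simp
  then show ?thesis
    using \<open>r > 0\<close> by (simp add: r_def[symmetric] field_simps)
qed

end

section \<open>Compositions, powers and finite sums of operators\<close>

lemma Lp_bounded_operator_compose:
  assumes "1 \<le> p" and S: "Lp_bounded_operator p M S" and T: "Lp_bounded_operator p M T"
  shows "Lp_bounded_operator p M (\<lambda>f. S (T f))"
proof -
  note closed = Lp_operator_closed[OF S] Lp_operator_closed[OF T]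
  obtain C where C: "C \<ge> 0" "\<And>f. f \<in> Lp_space p M \<Longrightarrow> Lp_norm p M (S f) \<le> C * Lp_norm p M f"
    by (fact Lp_operator_bound[OF S])
  obtain D where D: "D \<ge> 0" "\<And>f. f \<in> Lp_space p M \<Longrightarrow> Lp_norm p M (T f) \<le> D * Lp_norm p M f"
    by (fact Lp_operator_bound[OF T])
  have add: "AE x in M. S (T (\<lambda>y. f y + g y)) x = S (T f) x + S (T g) x"
    if fg: "f \<in> Lp_space p M" "g \<in> Lp_space p M" for f g
  proof -
    \<comment> \<open>Additivity of \<open>T\<close> is only an identity almost everywhere; it
      passes under \<open>S\<close> because \<open>S\<close> respects almost-everywhere
      equality.\<close>
    have "AE x in M. S (T (\<lambda>y. f y + g y)) x = S (\<lambda>y. T f y + T g y) x"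
      using fg by (intro Lp_operator_cong[OF S] Lp_operator_add[OF T] Lp_space_add assms(1) closed)
    moreover have "AE x in M. S (\<lambda>y. T f y + T g y) x = S (T f) x + S (T g) x"
      using fg closed by (intro Lp_operator_add[OF S])
    ultimately show ?thesis
      by eventually_elim simp
  qed
  have scale: "AE x in M. S (T (\<lambda>y. c * f y)) x = c * S (T f) x" if f: "f \<in> Lp_space p M" for f c
  proof -
    have "AE x in M. S (T (\<lambda>y. c * f y)) x = S (\<lambda>y. c * T f y) x"
      using f by (intro Lp_operator_cong[OF S] Lp_operator_scale[OF T] Lp_space_scale closed)
    moreover have "AE x in M. S (\<lambda>y. c * T f y) x = c * S (T f) x"
      using f closed by (intro Lp_operator_scale[OF S])
    ultimately show ?thesis
      by eventually_elim simp
  qed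
  have "Lp_norm p M (S (T f)) \<le> C * D * Lp_norm p M f" if "f \<in> Lp_space p M" for f
    using C(2)[of "T f"] mult_left_mono[OF D(2)[OF that] C(1)] closed that by simp
  then show ?thesis
    unfolding Lp_bounded_operator_def
    by (intro conjI ballI allI impI add scale closed Lp_operator_cong[OF S] Lp_operator_cong[OF T]) blast+
qed

lemma Lp_bounded_operator_funpow:
  assumes "1 \<le> p" "Lp_bounded_operator p M T"
  shows "Lp_bounded_operator p M (T ^^ n)"
proof (induction n)
  case 0
  show ?case
    by (auto simp: Lp_bounded_operator_def intro!: exI[of _ 1])
next
  case (Suc n)
  then show ?case
    using Lp_bounded_operator_compose[OF assms Suc.IH] by (simp add: comp_def)
qed

text \<open>Only the existence of some bound matters here; the quantitative bounds for sums of
  powers come later from the Cesaro hypothesis.\<close>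

lemma Lp_bounded_operator_sum:
  fixes M :: "'a measure"
  assumes "1 \<le> p" "finite I" and S: "\<And>i. i \<in> I \<Longrightarrow> Lp_bounded_operator p M (S i)"
  shows "Lp_bounded_operator p M (\<lambda>f x. \<Sum>i\<in>I. S i f x)"
  unfolding Lp_bounded_operator_def
proof (intro conjI ballI allI impI)
  fix f g :: "'a \<Rightarrow> complex" and c
  assume f: "f \<in> Lp_space p M"
  show "(\<lambda>x. \<Sum>i\<in>I. S i f x) \<in> Lp_space p M"
    using assms f by (intro Lp_space_sum Lp_operator_closed[OF S]) auto
  have "AE x in M. \<forall>i\<in>I. S i (\<lambda>y. c * f y) x = c * S i f x"
    using assms f by (intro AE_finite_allI Lp_operator_scale[OF S])
  then show "AE x in M. (\<Sum>i\<in>I. S i (\<lambda>y. c * f y) x) = c * (\<Sum>i\<in>I. S i f x)"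
    by eventually_elim (simp add: sum_distrib_left)
  assume g: "g \<in> Lp_space p M"
  have "AE x in M. \<forall>i\<in>I. S i (\<lambda>y. f y + g y) x = S i f x + S i g x"
    using assms f g by (intro AE_finite_allI Lp_operator_add[OF S])
  then show "AE x in M. (\<Sum>i\<in>I. S i (\<lambda>y. f y + g y) x) = (\<Sum>i\<in>I. S i f x) + (\<Sum>i\<in>I. S i g x)"
    by eventually_elim (simp add: sum.distrib)
  assume "AE x in M. f x = g x"
  then have "AE x in M. \<forall>i\<in>I. S i f x = S i g x"
    using assms f g by (intro AE_finite_allI Lp_operator_cong[OF S])
  then show "AE x in M. (\<Sum>i\<in>I. S i f x) = (\<Sum>i\<in>I. S i g x)"
    by eventually_elim simp
next
  have "\<exists>C\<ge>0. \<forall>f\<in>Lp_space p M. Lp_int p M (S i f) \<le> C powr p * Lp_int p M f" if i: "i \<in> I" for i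
    proof -
    obtain C where "C \<ge> 0" "\<And>f. f \<in> Lp_space p M \<Longrightarrow> Lp_norm p M (S i f) \<le> C * Lp_norm p M f"
      by (fact Lp_operator_bound[OF S[OF i]])
    then show ?thesis
      using assms(1) by (intro exI[of _ C]) (simp add: Lp_int_le_iff)
  qed
  then obtain C where C: "\<And>i f. i \<in> I \<Longrightarrow> f \<in> Lp_space p M \<Longrightarrow> Lp_int p M (S i f) \<le> C i powr p * Lp_int p M f"
    by metis
  let ?E = "real (card I) powr p * (\<Sum>i\<in>I. C i powr p)"
  have "Lp_norm p M (\<lambda>x. \<Sum>i\<in>I. S i f x) \<le> ?E powr (1/p) * Lp_norm p M f" if f: "f \<in> Lp_space p M" for f
  proof -
    have "Lp_int p M (\<lambda>x. \<Sum>i\<in>I. S i f x) \<le> real (card I) powr p * (\<Sum>i\<in>I. Lp_int p M (S i f))"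
      using assms f by (intro Lp_int_sum_le Lp_operator_closed[OF S]) auto
    also have "\<dots> \<le> real (card I) powr p * (\<Sum>i\<in>I. C i powr p * Lp_int p M f)"
      using C f by (intro mult_left_mono sum_mono) auto
    also have "\<dots> = (?E powr (1/p)) powr p * Lp_int p M f"
      using assms by (simp add: powr_powr sum_nonneg sum_distrib_right)
    finally show ?thesis
      using assms by (subst Lp_int_le_iff[symmetric]) auto
  qed
  then show "\<exists>C. \<forall>f\<in>Lp_space p M. Lp_norm p M (\<lambda>x. \<Sum>i\<in>I. S i f x) \<le> C * Lp_norm p M f"
    by blast
qed

lemma Lp_operator_sum:
  assumes "1 \<le> p" and S: "Lp_bounded_operator p M S"
    and "finite I" "\<And>i. i \<in> I \<Longrightarrow> f i \<in> Lp_space p M"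
  shows "AE x in M. S (\<lambda>y. \<Sum>i\<in>I. f i y) x = (\<Sum>i\<in>I. S (f i) x)"
  using assms(3,4)
proof (induction I rule: finite_induct)
  case empty
  then show ?case
    using Lp_operator_scale[OF S Lp_space_zero, of 0] by simp
next
  case (insert i I)
  then have "(\<lambda>y. \<Sum>i\<in>I. f i y) \<in> Lp_space p M"
    using assms(1) by (intro Lp_space_sum) auto
  then have "AE x in M. S (\<lambda>y. f i y + (\<Sum>i\<in>I. f i y)) x = S (f i) x + S (\<lambda>y. \<Sum>i\<in>I. f i y) x"
    using insert by (intro Lp_operator_add[OF S]) auto
  moreover have "AE x in M. S (\<lambda>y. \<Sum>i\<in>I. f i y) x = (\<Sum>i\<in>I. S (f i) x)"
    using insert by auto
  ultimately show ?case
    by eventually_elim (use insert in simp)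
qed

section \<open>Positive operators\<close>

lemma Lp_positiveD:
  "Lp_positive p M S \<Longrightarrow> f \<in> Lp_space p M \<Longrightarrow> AE x in M. f x \<in> \<real>\<^sub>\<ge>\<^sub>0 \<Longrightarrow> AE x in M. S f x \<in> \<real>\<^sub>\<ge>\<^sub>0"
  by (simp add: Lp_positive_def)

text \<open>Almost everywhere \<open>S g\<close> is the sum of \<open>S f\<close> and
  \<open>S (g - f)\<close>, both nonnegative.\<close>

lemma Lp_positive_mono:
  assumes "1 \<le> p" and S: "Lp_bounded_operator p M S" "Lp_positive p M S"
    and f: "f \<in> Lp_space p M" "AE x in M. f x \<in> \<real>\<^sub>\<ge>\<^sub>0" and g: "g \<in> Lp_space p M"
    and fg: "AE x in M. g x - f x \<in> \<real>\<^sub>\<ge>\<^sub>0"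
  shows "AE x in M. cmod (S f x) \<le> cmod (S g x)"
proof -
  let ?h = "\<lambda>x. g x - f x"
  have h: "?h \<in> Lp_space p M"
    using Lp_space_add[OF assms(1) g Lp_space_scale[OF f(1), of "-1"]] by simp
  have "AE x in M. S g x = S f x + S ?h x"
    using Lp_operator_add[OF S(1) f(1) h] by simp
  moreover note Lp_positiveD[OF S(2) f] Lp_positiveD[OF S(2) h fg]
  ultimately show ?thesis
    by eventually_elim (auto elim!: nonneg_Reals_cases simp flip: of_real_add)
qed

text \<open>This takes the place of the duality between \<open>L\<^sup>p\<close> and its dual space: the hypothesis is an
  upper estimate for a single function, applied to the majorant \<open>(\<Sum>\<^sub>i f\<^sub>i\<^sup>p)\<^bsup>1/p\<^esup>\<close> of all \<open>f\<^sub>i\<close>.\<close>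

lemma Lp_int_sum_positive_le:
  fixes f :: "'i \<Rightarrow> 'a \<Rightarrow> complex"
  assumes p: "1 \<le> p" and "finite I"
    and S: "\<And>i. i \<in> I \<Longrightarrow> Lp_bounded_operator p M (S i)" "\<And>i. i \<in> I \<Longrightarrow> Lp_positive p M (S i)"
    and f: "\<And>i. i \<in> I \<Longrightarrow> f i \<in> Lp_space p M" "\<And>i. i \<in> I \<Longrightarrow> AE x in M. f i x \<in> \<real>\<^sub>\<ge>\<^sub>0"
    and D: "\<And>h. h \<in> Lp_space p M \<Longrightarrow> AE x in M. h x \<in> \<real>\<^sub>\<ge>\<^sub>0 \<Longrightarrow>
      Lp_int p M (\<lambda>x. \<Sum>i\<in>I. S i h x) \<le> D * Lp_int p M h"
  shows "Lp_int p M (\<lambda>x. \<Sum>i\<in>I. S i (f i) x) \<le> D * (\<Sum>i\<in>I. Lp_int p M (f i))"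
proof -
  define F where "F x = complex_of_real ((\<Sum>i\<in>I. cmod (f i x) powr p) powr (1 / p))" for x
  have Fp: "cmod (F x) powr p = (\<Sum>i\<in>I. cmod (f i x) powr p)" for x
    using p by (simp add: F_def powr_powr sum_nonneg)
  have [measurable]: "f i \<in> borel_measurable M" if "i \<in> I" for i
    using f that by (simp add: Lp_space_def)
  have F_meas: "F \<in> borel_measurable M"
    unfolding F_def by measurable
  then have F: "F \<in> Lp_space p M"
    using f by (auto simp: Lp_space_def Fp)
  have le: "cmod (f i x) \<le> cmod (F x)" if "i \<in> I" for i x
  proof -
    have "cmod (f i x) powr p \<le> cmod (F x) powr p"
      unfolding Fp using that \<open>finite I\<close> by (intro member_le_sum) auto
    then show ?thesis
      using p by (smt (verit) norm_ge_zero powr_less_mono2)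
  qed
  have F_nonneg: "F x \<in> \<real>\<^sub>\<ge>\<^sub>0" for x
    by (simp add: F_def)
  have diff: "AE x in M. F x - f i x \<in> \<real>\<^sub>\<ge>\<^sub>0" if "i \<in> I" for i
    using f(2)[OF that]
  proof eventually_elim
    case (elim x)
    then have "F x - f i x = complex_of_real (cmod (F x) - cmod (f i x))"
      using F_nonneg[of x] by (simp add: of_real_cmod_nonneg_Reals)
    then show ?case
      using le[OF that, of x] by (simp only: nonneg_Reals_of_real_iff diff_ge_0_iff_ge)
  qed
  have "AE x in M. \<forall>i\<in>I. cmod (S i (f i) x) \<le> cmod (S i F x)"
    using assms F diff by (intro AE_finite_allI Lp_positive_mono[OF p S]) auto
  moreover have "AE x in M. \<forall>i\<in>I. S i F x \<in> \<real>\<^sub>\<ge>\<^sub>0"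
    using assms F F_nonneg by (intro AE_finite_allI Lp_positiveD[OF S(2)]) auto
  ultimately have "AE x in M. cmod (\<Sum>i\<in>I. S i (f i) x) \<le> cmod (\<Sum>i\<in>I. S i F x)"
  proof eventually_elim
    case (elim x)
    have "cmod (\<Sum>i\<in>I. S i (f i) x) \<le> (\<Sum>i\<in>I. cmod (S i F x))"
      using elim by (intro order.trans[OF norm_sum] sum_mono) auto
    then show ?case
      using elim by (simp add: cmod_sum_nonneg_Reals)
  qed
  then have "Lp_int p M (\<lambda>x. \<Sum>i\<in>I. S i (f i) x) \<le> Lp_int p M (\<lambda>x. \<Sum>i\<in>I. S i F x)"
    using assms F by (intro Lp_int_mono Lp_space_sum Lp_operator_closed[OF S(1)]) auto
  also have "\<dots> \<le> D * Lp_int p M F"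
    using F F_nonneg by (intro D) auto
  \<comment> \<open>The exponents in \<open>F\<close> are chosen to make this an equality, so
    passing to the common majorant costs no constant.\<close>
  also have "Lp_int p M F = (\<Sum>i\<in>I. Lp_int p M (f i))"
    using f by (simp add: Lp_int_def Fp Lp_space_def)
  finally show ?thesis .
qed

text \<open>For \<open>k = 0, 1, 2, 3\<close> the real part of \<open>(- \<i>) ^ k * z\<close> is
  \<open>Re z\<close>, \<open>Im z\<close>, \<open>- Re z\<close>, \<open>- Im z\<close>, so this is
  the splitting of \<open>z\<close> into positive and negative parts of its real and imaginary
  part.\<close>

lemma complex_eq_sum_nonneg_parts:
  "z = (\<Sum>k<4. \<i> ^ k * complex_of_real (max 0 (Re ((- \<i>) ^ k * z))))"
proof -
  have "{..<4::nat} = {0, 1, 2, 3}"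
    by auto
  then show ?thesis
    by (simp add: complex_eq_iff power2_eq_square power3_eq_cube max_def)
qed

text \<open>The function splits into four nonnegative parts, each dominated by its modulus. The
  factor \<open>4 powr p\<close> comes from \<open>Lp_int_sum_le\<close> with four terms, the other
  4 from adding four equal bounds.\<close>

lemma Lp_int_operator_le_of_nonneg:
  assumes p: "1 \<le> p" and S: "Lp_bounded_operator p M S" and "0 \<le> D"
    and D: "\<And>h. h \<in> Lp_space p M \<Longrightarrow> AE x in M. h x \<in> \<real>\<^sub>\<ge>\<^sub>0 \<Longrightarrow>
      Lp_int p M (S h) \<le> D * Lp_int p M h"
    and f: "f \<in> Lp_space p M"
  shows "Lp_int p M (S f) \<le> 4 powr p * (4 * D) * Lp_int p M f"
proof -
  define h where "h k x = complex_of_real (max 0 (Re ((- \<i>) ^ k * f x)))" for k :: nat and x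
  have h_le: "cmod (h k x) \<le> cmod (f x)" for k x
    using complex_Re_le_cmod[of "(- \<i>) ^ k * f x"] by (auto simp: h_def norm_mult norm_power)
  have [measurable]: "f \<in> borel_measurable M"
    using f by (simp add: Lp_space_def)
  have "h k \<in> borel_measurable M" for k
    unfolding h_def by measurable
  then have h: "h k \<in> Lp_space p M" for k
    using p h_le by (intro Lp_space_dominated[OF _ f]) auto
  have Sh: "Lp_int p M (S (h k)) \<le> D * Lp_int p M f" for k
  proof -
    have "Lp_int p M (S (h k)) \<le> D * Lp_int p M (h k)"
      by (rule D[OF h]) (simp add: h_def)
    also have "\<dots> \<le> D * Lp_int p M f"
      using p f h h_le by (intro mult_left_mono Lp_int_mono \<open>0 \<le> D\<close>) auto
    finally show ?thesis .
  qed
  have f_eq: "f = (\<lambda>x. \<Sum>k<4. \<i> ^ k * h k x)"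
    unfolding h_def by (rule ext) (rule complex_eq_sum_nonneg_parts)
  have ih: "(\<lambda>x. \<i> ^ k * h k x) \<in> Lp_space p M" for k
    using h by (rule Lp_space_scale)
  have "AE x in M. S f x = (\<Sum>k<4. S (\<lambda>x. \<i> ^ k * h k x) x)"
    using Lp_operator_sum[OF p S, of "{..<4}" "\<lambda>k x. \<i> ^ k * h k x"] ih f_eq by simp
  moreover have Sih: "S (\<lambda>x. \<i> ^ k * h k x) \<in> Lp_space p M" for k
    by (rule Lp_operator_closed[OF S ih])
  ultimately have "Lp_int p M (S f) = Lp_int p M (\<lambda>x. \<Sum>k<4. S (\<lambda>x. \<i> ^ k * h k x) x)"
    using p S f by (intro Lp_int_cong_AE Lp_space_sum Lp_operator_closed[OF S f] Sih) (auto elim: eventually_mono)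
  also have "\<dots> \<le> 4 powr p * (\<Sum>k<4. Lp_int p M (S (\<lambda>x. \<i> ^ k * h k x)))"
    using Lp_int_sum_le[OF p, of "{..<4}" "\<lambda>k. S (\<lambda>x. \<i> ^ k * h k x)"] Sih by simp
  also have "(\<Sum>k<4. Lp_int p M (S (\<lambda>x. \<i> ^ k * h k x))) \<le> (\<Sum>k<4::nat. D * Lp_int p M f)"
  proof (intro sum_mono)
    fix k
    \<comment> \<open>The scalar \<open>\<i> ^ k\<close> comes out of \<open>S\<close> almost
      everywhere and has modulus 1.\<close>
    have "Lp_int p M (S (\<lambda>x. \<i> ^ k * h k x)) = Lp_int p M (S (h k))"
      using S h Sih Lp_operator_scale[OF S h[of k], of "\<i> ^ k"]
      by (intro Lp_int_cong_AE Sih Lp_operator_closed[OF S h])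
        (auto simp: norm_mult norm_power elim: eventually_mono)
    then show "Lp_int p M (S (\<lambda>x. \<i> ^ k * h k x)) \<le> D * Lp_int p M f"
      using Sh by simp
  qed
  finally show ?thesis
    by (simp add: mult_ac)
qed

subsection \<open>Growth of the powers\<close>

text \<open>\<open>A\<close> bounds the norms of all Cesaro means. The bound is stated for p-th
  powers and includes \<open>n = 0\<close>, where both sides vanish.\<close>

locale Lp_eventually_positive_Cesaro =
  fixes p :: real and M :: "'a measure" and T :: "('a \<Rightarrow> complex) \<Rightarrow> ('a \<Rightarrow> complex)"
    and n0 :: nat and A :: real
  assumes p: "1 < p"
    and bounded: "Lp_bounded_operator p M T"
    and positive: "n0 \<le> n \<Longrightarrow> Lp_positive p M (T ^^ n)"
    and A_nonneg: "0 \<le> A"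
    and Cesaro: "f \<in> Lp_space p M \<Longrightarrow> Lp_int p M (\<lambda>x. \<Sum>k<n. (T ^^ k) f x) \<le> (A * real n) powr p * Lp_int p M f"
begin

section \<open>The direct and the dual Cesaro estimate\<close>

lemma powers_bounded: "Lp_bounded_operator p M (T ^^ n)"
  using p bounded by (intro Lp_bounded_operator_funpow) auto

lemma powers_closed: "f \<in> Lp_space p M \<Longrightarrow> (T ^^ n) f \<in> Lp_space p M"
  using powers_bounded by (rule Lp_operator_closed)

lemma powers_nonneg:
  "n0 \<le> n \<Longrightarrow> f \<in> Lp_space p M \<Longrightarrow> AE x in M. f x \<in> \<real>\<^sub>\<ge>\<^sub>0 \<Longrightarrow> AE x in M. (T ^^ n) f x \<in> \<real>\<^sub>\<ge>\<^sub>0"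
  using positive by (rule Lp_positiveD)

text \<open>From \<open>n0\<close> on the terms are nonnegative, so a partial sum is dominated by
  the sum over \<open>{n0..<m}\<close>. The latter is the difference of the Cesaro sums of lengths
  \<open>m\<close> and \<open>n0\<close>, both bounded by the hypothesis.\<close>

lemma Cesaro_subset:
  assumes "I \<subseteq> {n0..<m}" and f: "f \<in> Lp_space p M" "AE x in M. f x \<in> \<real>\<^sub>\<ge>\<^sub>0"
  shows "Lp_int p M (\<lambda>x. \<Sum>k\<in>I. (T ^^ k) f x) \<le> (4 * A * real m) powr p * Lp_int p M f"
proof (cases "n0 \<le> m")
  case False
  then have "I = {}"
    using assms by auto
  then show ?thesis
    by (simp add: Lp_int_def)
next
  case True
  have p1: "1 \<le> p"
    using p by simp
  have fin: "finite I"
    using assms(1) finite_subset by blast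
  \<comment> \<open>The two Cesaro sums, the second negated, are indexed by booleans so that the
    estimate for finite sums applies to their difference.\<close>
  define g where "g b = (if b then \<lambda>x. \<Sum>k<m. (T ^^ k) f x else (\<lambda>x. - (\<Sum>k<n0. (T ^^ k) f x)))" for b
  have g: "g b \<in> Lp_space p M" for b
    unfolding g_def using p1 powers_closed[OF f(1)]
    by (simp add: Lp_space_sum Lp_space_minus)
  have g_int: "Lp_int p M (g b) \<le> (A * real m) powr p * Lp_int p M f" for b
  proof (cases b)
    case True
    then show ?thesis
      using Cesaro[OF f(1)] by (simp add: g_def)
  next
    case False
    then have "Lp_int p M (g b) \<le> (A * real n0) powr p * Lp_int p M f"
      using Cesaro[OF f(1), of n0] by (simp add: g_def Lp_int_def)
    also have "\<dots> \<le> (A * real m) powr p * Lp_int p M f"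
      using \<open>n0 \<le> m\<close> A_nonneg p
      by (intro mult_right_mono powr_mono2 mult_left_mono Lp_int_nonneg) auto
    finally show ?thesis .
  qed
  have "AE x in M. \<forall>k\<in>{n0..<m}. (T ^^ k) f x \<in> \<real>\<^sub>\<ge>\<^sub>0"
    using powers_nonneg f by (intro AE_finite_allI) auto
  then have "AE x in M. cmod (\<Sum>k\<in>I. (T ^^ k) f x) \<le> cmod (\<Sum>b\<in>UNIV. g b x)"
  proof eventually_elim
    case (elim x)
    have "(\<Sum>b\<in>UNIV. g b x) = (\<Sum>k\<in>{n0..<m}. (T ^^ k) f x)"
      using sum_diff_nat_ivl[OF _ True, of 0 "\<lambda>k. (T ^^ k) f x"]
      by (simp add: g_def UNIV_bool atLeast0LessThan)
    moreover have "(\<Sum>k\<in>I. cmod ((T ^^ k) f x)) \<le> (\<Sum>k\<in>{n0..<m}. cmod ((T ^^ k) f x))"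
      using assms(1) by (intro sum_mono2) auto
    moreover have "cmod (\<Sum>k\<in>I. (T ^^ k) f x) = (\<Sum>k\<in>I. cmod ((T ^^ k) f x))"
      using elim assms(1) by (intro cmod_sum_nonneg_Reals) auto
    moreover have "cmod (\<Sum>k\<in>{n0..<m}. (T ^^ k) f x) = (\<Sum>k\<in>{n0..<m}. cmod ((T ^^ k) f x))"
      using elim by (intro cmod_sum_nonneg_Reals) auto
    ultimately show ?case
      by simp
  qed
  then have "Lp_int p M (\<lambda>x. \<Sum>k\<in>I. (T ^^ k) f x) \<le> Lp_int p M (\<lambda>x. \<Sum>b\<in>UNIV. g b x)"
    using p p1 fin f powers_closed g by (intro Lp_int_mono Lp_space_sum) auto
  also have "\<dots> \<le> 2 powr p * (\<Sum>b\<in>UNIV. Lp_int p M (g b))"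
    using Lp_int_sum_le[OF p1, of UNIV g] g by simp
  also have "\<dots> \<le> 2 powr p * (2 * ((A * real m) powr p * Lp_int p M f))"
    using g_int[of True] g_int[of False] by (intro mult_left_mono) (auto simp: UNIV_bool)
  \<comment> \<open>As \<open>p \<ge> 1\<close>, the count 2 is absorbed as
    \<open>2 \<le> 2 powr p\<close>; the two factors combine to the 4 in the claim.\<close>
  also have "\<dots> \<le> 2 powr p * (2 powr p * ((A * real m) powr p * Lp_int p M f))"
    using p powr_mono[of 1 p 2] A_nonneg
    by (intro mult_left_mono mult_right_mono mult_nonneg_nonneg Lp_int_nonneg) auto
  also have "\<dots> = (4 * A * real m) powr p * Lp_int p M f"
    using A_nonneg powr_mult[of 2 2 p] by (simp add: powr_mult)
  finally show ?thesis .
qed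

lemma sum_Lp_int_powers_le:
  assumes "I \<subseteq> {n0..<m}" and f: "f \<in> Lp_space p M" "AE x in M. f x \<in> \<real>\<^sub>\<ge>\<^sub>0"
  shows "(\<Sum>k\<in>I. Lp_int p M ((T ^^ k) f)) \<le> (4 * A * real m) powr p * Lp_int p M f"
proof -
  have "(\<Sum>k\<in>I. Lp_int p M ((T ^^ k) f)) \<le> Lp_int p M (\<lambda>x. \<Sum>k\<in>I. (T ^^ k) f x)"
    using p assms powers_closed powers_nonneg finite_subset[OF assms(1)]
    by (intro Lp_int_sum_ge) (auto simp: subset_iff)
  also note Cesaro_subset[OF assms]
  finally show ?thesis .
qed

text \<open>The dual estimate. The map \<open>q\<close> allows the exponents \<open>k\<close> as
  well as \<open>n - k\<close>; injectivity makes the sum of the \<open>T ^^ q i\<close> a sum over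
  distinct powers, to which \<open>Cesaro_subset\<close> applies.\<close>

lemma Lp_int_sum_powers_le:
  assumes "inj_on q I" "q ` I \<subseteq> {n0..<m}" "finite I"
    and f: "\<And>i. i \<in> I \<Longrightarrow> f i \<in> Lp_space p M" "\<And>i. i \<in> I \<Longrightarrow> AE x in M. f i x \<in> \<real>\<^sub>\<ge>\<^sub>0"
  shows "Lp_int p M (\<lambda>x. \<Sum>i\<in>I. (T ^^ q i) (f i) x)
    \<le> (4 * A * real m) powr p * (\<Sum>i\<in>I. Lp_int p M (f i))"
proof (rule Lp_int_sum_positive_le)
  fix h assume h: "h \<in> Lp_space p M" "AE x in M. h x \<in> \<real>\<^sub>\<ge>\<^sub>0"
  show "Lp_int p M (\<lambda>x. \<Sum>i\<in>I. (T ^^ q i) h x) \<le> (4 * A * real m) powr p * Lp_int p M h"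
    using Cesaro_subset[OF assms(2) h] by (simp add: sum.reindex[OF assms(1)])
qed (use p assms powers_bounded positive in auto)

section \<open>Dyadic averaging over the two factorizations of a power\<close>

context
  fixes a b n :: nat and f
  assumes ab: "n0 \<le> 2 ^ a" "a < b" "2 * 2 ^ b \<le> n"
    and f: "f \<in> Lp_space p M" "AE x in M. f x \<in> \<real>\<^sub>\<ge>\<^sub>0"
begin

text \<open>The \<open>b - a\<close> dyadic blocks start at \<open>2 ^ a \<ge> n0\<close>, so every
  exponent in them gives a positive power.\<close>

lemma n0_le_block:
  assumes "k \<in> {2 ^ j..<2 ^ Suc j}" "a \<le> j"
  shows "n0 \<le> k"
proof -
  have "(2::nat) ^ a \<le> 2 ^ j"
    using assms by simp
  with ab assms show ?thesis
    unfolding atLeastLessThan_iff by linarith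
qed

text \<open>The complementary exponents give positive powers too: \<open>2 * 2 ^ b \<le> n\<close>
  leaves \<open>n - k \<ge> 2 ^ b \<ge> n0\<close>.\<close>

lemma n0_le_diff:
  assumes "k < 2 ^ b"
  shows "n0 \<le> n - k"
proof -
  have "(2::nat) ^ a \<le> 2 ^ b"
    using ab by simp
  with ab assms show ?thesis
    by linarith
qed

lemma powers_diff: "k < 2 ^ b \<Longrightarrow> (T ^^ k) ((T ^^ (n - k)) f) = (T ^^ n) f"
    "k < 2 ^ b \<Longrightarrow> (T ^^ (n - k)) ((T ^^ k) f) = (T ^^ n) f"
  using ab funpow_add[of k "n - k" T] funpow_add[of "n - k" k T] by (simp_all add: fun_eq_iff)

lemma inj_on_diff: "inj_on ((-) n) {2 ^ a..<2 ^ b}"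
proof (rule inj_onI)
  fix x y assume "x \<in> {2 ^ a..<2 ^ b}" "y \<in> {2 ^ a..<2 ^ b}" "n - x = n - y"
  with ab show "x = y"
    unfolding atLeastLessThan_iff by linarith
qed

lemma diff_image_subset: "(-) n ` {2 ^ a..<2 ^ b} \<subseteq> {n0..<n}"
proof
  fix y assume "y \<in> (-) n ` {2 ^ a..<2 ^ b}"
  then obtain x where x: "y = n - x" "2 ^ a \<le> x" "x < 2 ^ b"
    by auto
  \<comment> \<open>This makes \<open>n - x\<close> strictly smaller than \<open>n\<close>, as the
    half-open interval demands.\<close>
  have "0 < x"
    using x(2) by (intro gr0I) simp
  then show "y \<in> {n0..<n}"
    using x ab n0_le_diff[OF x(3)] by auto
qed

text \<open>\<open>T ^^ n\<close> is written as \<open>T ^^ k\<close> after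
  \<open>T ^^ (n - k)\<close>. The dual estimate is applied in each block, the direct one once to
  all exponents \<open>n - k\<close> together. Each block contributes one copy of the left side,
  whence the exponent \<open>1 / p\<close> after taking roots.\<close>

lemma Lp_int_power_le_forward:
  "real (b - a) * Lp_int p M ((T ^^ n) f) \<le> (32 * A\<^sup>2 * real n) powr p * Lp_int p M f"
proof -
  have "Lp_int p M ((T ^^ n) f) \<le> (8 * A) powr p * (\<Sum>k=2^j..<2^Suc j. Lp_int p M ((T ^^ (n - k)) f))"
    if j: "j \<in> {a..<b}" for j
  proof -
    let ?B = "{2^j..<2^Suc j} :: nat set"
    have lt: "k < 2 ^ b" if "k \<in> ?B" for k
      using that j power_increasing[of "Suc j" b "2::nat"] by auto
    have "(2 ^ j) powr p * Lp_int p M ((T ^^ n) f) = Lp_int p M (\<lambda>x. 2 ^ j * (T ^^ n) f x)"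
      using Lp_int_scale[of p M "2 ^ j"] by (simp add: norm_power)
    also have "(\<lambda>x. 2 ^ j * (T ^^ n) f x) = (\<lambda>x. \<Sum>k\<in>?B. (T ^^ k) ((T ^^ (n - k)) f) x)"
      using powers_diff(1)[OF lt] by simp
    also have "Lp_int p M \<dots> \<le> (4 * A * real (2 ^ Suc j)) powr p * (\<Sum>k\<in>?B. Lp_int p M ((T ^^ (n - k)) f))"
    proof (rule Lp_int_sum_powers_le)
      show "(\<lambda>k. k) ` ?B \<subseteq> {n0..<2 ^ Suc j}"
        using j n0_le_block[of _ j] by auto
      show "AE x in M. (T ^^ (n - k)) f x \<in> \<real>\<^sub>\<ge>\<^sub>0" if "k \<in> ?B" for k
        using that f lt by (intro powers_nonneg n0_le_diff)
    qed (use f in \<open>auto intro!: powers_closed\<close>)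
    \<comment> \<open>The bound \<open>2 ^ Suc j\<close> on the exponents is twice the block length,
      so the length cancels and leaves a constant independent of \<open>j\<close>.\<close>
    also have "\<dots> = (2 ^ j) powr p * ((8 * A) powr p * (\<Sum>k\<in>?B. Lp_int p M ((T ^^ (n - k)) f)))"
      using A_nonneg by (simp add: powr_mult mult_ac flip: powr_mult)
    finally show ?thesis
      by simp
  qed
  then have "(\<Sum>j=a..<b. Lp_int p M ((T ^^ n) f))
      \<le> (\<Sum>j=a..<b. (8 * A) powr p * (\<Sum>k=2^j..<2^Suc j. Lp_int p M ((T ^^ (n - k)) f)))"
    by (rule sum_mono)
  then have "real (b - a) * Lp_int p M ((T ^^ n) f)
      \<le> (8 * A) powr p * (\<Sum>k=2^a..<2^b. Lp_int p M ((T ^^ (n - k)) f))"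
    by (simp only: sum_dyadic_blocks[OF less_imp_le[OF ab(2)]] sum_distrib_left sum_constant card_atLeastLessThan)
  also have "(\<Sum>k=2^a..<2^b. Lp_int p M ((T ^^ (n - k)) f))
      = (\<Sum>k\<in>(-) n ` {2^a..<2^b}. Lp_int p M ((T ^^ k) f))"
    by (simp add: sum.reindex[OF inj_on_diff])
  also have "\<dots> \<le> (4 * A * real n) powr p * Lp_int p M f"
    by (intro sum_Lp_int_powers_le diff_image_subset f)
  also have "(8 * A) powr p * ((4 * A * real n) powr p * Lp_int p M f)
      = ((8 * A) * (4 * A * real n)) powr p * Lp_int p M f"
    by (simp only: powr_mult mult_ac)
  also have "(8 * A) * (4 * A * real n) = 32 * A\<^sup>2 * real n"
    by (simp add: power2_eq_square)
  finally show ?thesis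
    by (simp add: mult_left_mono)
qed

text \<open>\<open>T ^^ n\<close> is written as \<open>T ^^ (n - k)\<close> after
  \<open>T ^^ k\<close> with weight \<open>1 / k\<close>. Here the dual estimate is applied once to
  the whole range and the direct one in each block. With \<open>L = b - a\<close>, the weights give
  a factor of order \<open>L powr p\<close> on the left and the blocks a factor \<open>L\<close> on
  the right; the quotient \<open>L powr (p - 1)\<close> yields the exponent
  \<open>1 - 1 / p\<close>.\<close>

lemma Lp_int_power_le_backward:
  "real (b - a) powr (p - 1) * Lp_int p M ((T ^^ n) f) \<le> (64 * A\<^sup>2 * real n) powr p * Lp_int p M f"
proof -
  let ?K = "{2^a..<2^b} :: nat set"
  define w where "w k = complex_of_real (1 / real k)" for k
  have block: "real (b - a) * c = (\<Sum>j=a..<b. c)" for c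
    by simp
  \<comment> \<open>Each block has \<open>2 ^ j\<close> terms, each at least
    \<open>1 / 2 ^ Suc j\<close>, and so contributes at least one half to the harmonic sum.\<close>
  have "real (b - a) * (1 / 2) \<le> (\<Sum>k\<in>?K. 1 / real k)"
    unfolding block sum_dyadic_blocks[OF less_imp_le[OF ab(2)]]
  proof (intro sum_mono)
    fix j
    have "(1 / 2 :: real) = (\<Sum>k=2^j..<2^Suc j::nat. 1 / 2 ^ Suc j)"
      by simp
    also have "\<dots> \<le> (\<Sum>k=2^j..<2^Suc j. 1 / real k)"
    proof (intro sum_mono divide_left_mono)
      fix k :: nat assume k: "k \<in> {2^j..<2^Suc j}"
      then have "real k \<le> real (2 ^ Suc j)"
        by (intro of_nat_mono) auto
      then show "real k \<le> 2 ^ Suc j"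
        by simp
      have "0 < k"
        using k by (auto intro: less_le_trans[of 0 "2 ^ j"])
      then show "0 < 2 ^ Suc j * real k"
        by simp
    qed simp
    finally show "1 / 2 \<le> (\<Sum>k=2^j..<2^Suc j. 1 / real k)" .
  qed
  then have "(real (b - a) * (1 / 2)) powr p * Lp_int p M ((T ^^ n) f)
      \<le> (\<Sum>k\<in>?K. 1 / real k) powr p * Lp_int p M ((T ^^ n) f)"
    using p by (intro mult_right_mono powr_mono2 Lp_int_nonneg) auto
  also have "\<dots> = Lp_int p M (\<lambda>x. complex_of_real (\<Sum>k\<in>?K. 1 / real k) * (T ^^ n) f x)"
    by (simp only: Lp_int_scale norm_of_real) (simp add: sum_nonneg)
  also have "\<dots> = Lp_int p M (\<lambda>x. \<Sum>k\<in>?K. (T ^^ (n - k)) (\<lambda>y. w k * (T ^^ k) f y) x)"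
  proof (rule Lp_int_cong_AE)
    have "AE x in M. \<forall>k\<in>?K. (T ^^ (n - k)) (\<lambda>y. w k * (T ^^ k) f y) x = w k * (T ^^ (n - k)) ((T ^^ k) f) x"
      using f by (intro AE_finite_allI Lp_operator_scale[OF powers_bounded] powers_closed) auto
    then show "AE x in M. cmod (complex_of_real (\<Sum>k\<in>?K. 1 / real k) * (T ^^ n) f x)
        = cmod (\<Sum>k\<in>?K. (T ^^ (n - k)) (\<lambda>y. w k * (T ^^ k) f y) x)"
      by eventually_elim (simp add: powers_diff(2) w_def sum_distrib_right)
  qed (use p f in \<open>auto intro!: Lp_space_scale Lp_space_sum powers_closed\<close>)
  also have "\<dots> \<le> (4 * A * real n) powr p * (\<Sum>k\<in>?K. Lp_int p M (\<lambda>x. w k * (T ^^ k) f x))"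
  proof (rule Lp_int_sum_powers_le)
    show "inj_on ((-) n) ?K" "(-) n ` ?K \<subseteq> {n0..<n}"
      by (fact inj_on_diff diff_image_subset)+
    fix k assume k: "k \<in> ?K"
    show "(\<lambda>x. w k * (T ^^ k) f x) \<in> Lp_space p M"
      using f by (intro Lp_space_scale powers_closed)
    have "AE x in M. (T ^^ k) f x \<in> \<real>\<^sub>\<ge>\<^sub>0"
      using k ab f by (intro powers_nonneg) auto
    then show "AE x in M. w k * (T ^^ k) f x \<in> \<real>\<^sub>\<ge>\<^sub>0"
      by eventually_elim (auto simp: w_def intro!: nonneg_Reals_mult_I)
  qed simp
  \<comment> \<open>In block \<open>j\<close> the weights are at most \<open>1 / 2 ^ j\<close>,
    which cancels the growth of the direct estimate; every block obeys the same bound.\<close>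
  also have "(\<Sum>k\<in>?K. Lp_int p M (\<lambda>x. w k * (T ^^ k) f x)) \<le> real (b - a) * ((8 * A) powr p * Lp_int p M f)"
    unfolding block sum_dyadic_blocks[OF less_imp_le[OF ab(2)]]
  proof (intro sum_mono)
    fix j assume j: "j \<in> {a..<b}"
    let ?B = "{2^j..<2^Suc j} :: nat set"
    have "Lp_int p M (\<lambda>x. w k * (T ^^ k) f x) \<le> (1 / 2 ^ j) powr p * Lp_int p M ((T ^^ k) f)" if "k \<in> ?B" for k
    proof -
      have "real (2 ^ j) \<le> real k"
        using that by (intro of_nat_mono) auto
      then have "1 / real k \<le> 1 / 2 ^ j"
        by (intro divide_left_mono) (auto intro!: mult_pos_pos gr0I)
      then show ?thesis
        using p unfolding Lp_int_scale w_def norm_of_real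
        by (intro mult_right_mono powr_mono2 Lp_int_nonneg) auto
    qed
    then have "(\<Sum>k\<in>?B. Lp_int p M (\<lambda>x. w k * (T ^^ k) f x))
        \<le> (1 / 2 ^ j) powr p * (\<Sum>k\<in>?B. Lp_int p M ((T ^^ k) f))"
      unfolding sum_distrib_left by (rule sum_mono)
    also have "\<dots> \<le> (1 / 2 ^ j) powr p * ((4 * A * real (2 ^ Suc j)) powr p * Lp_int p M f)"
    proof (intro mult_left_mono sum_Lp_int_powers_le f)
      show "?B \<subseteq> {n0..<2 ^ Suc j}"
        using j n0_le_block[of _ j] by auto
    qed simp
    also have "\<dots> = ((1 / 2 ^ j) * (4 * A * real (2 ^ Suc j))) powr p * Lp_int p M f"
      using A_nonneg by (subst powr_mult) auto
    also have "(1 / 2 ^ j) * (4 * A * real (2 ^ Suc j)) = 8 * A"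
      by simp
    finally show "(\<Sum>k\<in>?B. Lp_int p M (\<lambda>x. w k * (T ^^ k) f x)) \<le> (8 * A) powr p * Lp_int p M f" .
  qed
  finally have "(real (b - a) * (1 / 2)) powr p * Lp_int p M ((T ^^ n) f)
      \<le> (4 * A * real n) powr p * (real (b - a) * ((8 * A) powr p * Lp_int p M f))"
    by (simp add: mult_left_mono)
  \<comment> \<open>Multiplying by \<open>2 powr p\<close> removes the one half per block; the
    constant becomes \<open>2 * 4 * 8 = 64\<close>.\<close>
  then have "2 powr p * ((real (b - a) * (1 / 2)) powr p * Lp_int p M ((T ^^ n) f))
      \<le> 2 powr p * ((4 * A * real n) powr p * (real (b - a) * ((8 * A) powr p * Lp_int p M f)))"
    by (rule mult_left_mono) simp
  also have "2 powr p * ((real (b - a) * (1 / 2)) powr p * Lp_int p M ((T ^^ n) f))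
      = (2 * (real (b - a) * (1 / 2))) powr p * Lp_int p M ((T ^^ n) f)"
    by (simp only: powr_mult mult_ac)
  also have "2 * (real (b - a) * (1 / 2)) = real (b - a)"
    by simp
  also have "real (b - a) powr p = real (b - a) * real (b - a) powr (p - 1)"
    using ab powr_add[of "real (b - a)" 1 "p - 1"] by simp
  also have "2 powr p * ((4 * A * real n) powr p * (real (b - a) * ((8 * A) powr p * Lp_int p M f)))
      = real (b - a) * ((2 * ((4 * A * real n) * (8 * A))) powr p * Lp_int p M f)"
    using A_nonneg by (simp only: powr_mult mult_ac)
  also have "2 * ((4 * A * real n) * (8 * A)) = 64 * A\<^sup>2 * real n"
    by (simp add: power2_eq_square)
  finally show ?thesis
    using ab by (simp add: mult.assoc)
qed

end

section \<open>From nonnegative functions to operator norms\<close>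

lemma Lp_opnorm_powers_le:
  assumes ab: "n0 \<le> 2 ^ a" "a < b" "2 * 2 ^ b \<le> n" and \<theta>: "\<theta> = 1 / p \<or> \<theta> = 1 - 1 / p"
  shows "Lp_opnorm p M (T ^^ n) \<le> 1024 * A\<^sup>2 * real n / real (b - a) powr \<theta>"
proof -
  define J where "J = real (b - a)"
  have J: "J > 0"
    using ab by (simp add: J_def)
  let ?D = "64 * A\<^sup>2 * real n / J powr \<theta>"
  have D_eq: "?D powr p = (64 * A\<^sup>2 * real n) powr p / J powr (\<theta> * p)"
    by (simp add: powr_divide powr_powr)
  have nonneg: "Lp_int p M ((T ^^ n) f) \<le> ?D powr p * Lp_int p M f"
    if f: "f \<in> Lp_space p M" "AE x in M. f x \<in> \<real>\<^sub>\<ge>\<^sub>0" for f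
  proof -
    \<comment> \<open>A common form of both estimates: \<open>\<theta> * p\<close> is 1 for the
      forward one and \<open>p - 1\<close> for the backward one.\<close>
    have "J powr (\<theta> * p) * Lp_int p M ((T ^^ n) f) \<le> (64 * A\<^sup>2 * real n) powr p * Lp_int p M f"
      using \<theta>
    proof
      assume "\<theta> = 1 / p"
      then have "J powr (\<theta> * p) * Lp_int p M ((T ^^ n) f) \<le> (32 * A\<^sup>2 * real n) powr p * Lp_int p M f"
        using Lp_int_power_le_forward[OF ab f] p J by (simp add: J_def)
      also have "\<dots> \<le> (64 * A\<^sup>2 * real n) powr p * Lp_int p M f"
        using p by (intro mult_right_mono powr_mono2 Lp_int_nonneg) auto
      finally show ?thesis .
    next
      assume "\<theta> = 1 - 1 / p"
      then have "\<theta> * p = p - 1"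
        using p by (simp add: field_simps)
      then show ?thesis
        using Lp_int_power_le_backward[OF ab f] by (simp add: J_def)
    qed
    then show ?thesis
      using J unfolding D_eq by (simp add: field_simps)
  qed
  \<comment> \<open>The splitting into four nonnegative parts costs \<open>4 powr p * 4\<close>, at
    most \<open>16 powr p\<close>; hence \<open>1024 = 16 * 64\<close>.\<close>
  have "Lp_norm p M ((T ^^ n) f) \<le> 16 * ?D * Lp_norm p M f" if f: "f \<in> Lp_space p M" for f
  proof -
    have "Lp_int p M ((T ^^ n) f) \<le> 4 powr p * (4 * ?D powr p) * Lp_int p M f"
      using p nonneg f by (intro Lp_int_operator_le_of_nonneg powers_bounded) auto
    also have "\<dots> \<le> 4 powr p * (4 powr p * ?D powr p) * Lp_int p M f"
      using p powr_mono[of 1 p 4] by (intro mult_right_mono mult_left_mono Lp_int_nonneg) auto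
    also have "4 powr p * (4 powr p * ?D powr p) = (4 * (4 * ?D)) powr p"
      by (simp only: powr_mult)
    also have "4 * (4 * ?D) = 16 * ?D"
      by simp
    finally show ?thesis
      using p by (subst (asm) Lp_int_le_iff) auto
  qed
  then have "Lp_opnorm p M (T ^^ n) \<le> 16 * ?D"
    by (intro Lp_opnorm_le powers_bounded) auto
  then show ?thesis
    by (simp add: J_def)
qed

lemma Lp_opnorm_powers_bigo:
  assumes \<theta>: "\<theta> = 1 / p \<or> \<theta> = 1 - 1 / p"
  shows "(\<lambda>n. Lp_opnorm p M (T ^^ n)) \<in> O(\<lambda>n. real n / ln (real n) powr \<theta>)"
proof (rule bigoI)
  have "filterlim (\<lambda>n. ln (real n)) at_top sequentially"
    by (rule filterlim_compose[OF ln_at_top filterlim_real_sequentially])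
  \<comment> \<open>This threshold leaves \<open>log 2 n\<close> at least \<open>n0 + 3\<close>
    above \<open>ln n / 2\<close>. Rounding and the shift in \<open>b\<close> lose at most 2, so
    \<open>b - n0\<close> still exceeds \<open>ln n / 2\<close>.\<close>
  then have "eventually (\<lambda>n. 2 * (real n0 + 3) \<le> ln (real n)) sequentially"
    by (simp add: filterlim_at_top)
  then show "\<forall>\<^sub>F n in sequentially. norm (Lp_opnorm p M (T ^^ n))
      \<le> (1024 * A\<^sup>2 * 2 powr \<theta>) * norm (real n / ln (real n) powr \<theta>)"
  proof eventually_elim
    case (elim n)
    \<comment> \<open>The largest \<open>b\<close> with \<open>2 * 2 ^ b \<le> n\<close>; the lower
      end of the blocks is \<open>a = n0\<close>, since \<open>n0 \<le> 2 ^ n0\<close>.\<close>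
    define b where "b = nat \<lfloor>log 2 (real n)\<rfloor> - 1"
    have "0 < 2 * (real n0 + 3)"
      by simp
    then have ln: "0 < ln (real n)"
      using elim by (rule less_le_trans)
    then have n: "n > 0"
      by (cases n) auto
    have "ln (real n) \<le> log 2 (real n)"
      using ln ln_2_less_1 by (simp add: log_def field_simps)
    moreover have "x / 2 + c + 3 \<le> y" if "2 * (c + 3) \<le> x" "x \<le> y" for x y c :: real
      using that by (simp add: field_simps)
    ultimately have log: "ln (real n) / 2 + real n0 + 3 \<le> log 2 (real n)"
      using elim by blast
    have "real (nat \<lfloor>log 2 (real n)\<rfloor>) > log 2 (real n) - 1"
      using ln log by linarith
    then have b: "real b \<ge> log 2 (real n) - 2" "real (Suc b) \<le> log 2 (real n)"
      using log ln unfolding b_def by linarith+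
    have n0: "n0 \<le> 2 ^ n0"
      by (simp add: less_imp_le)
    have "n0 < b"
      using b log ln by linarith
    have "2 powr real (Suc b) \<le> real n"
      using b(2) n by (subst (asm) le_log_iff) auto
    then have "real (2 ^ Suc b) \<le> real n"
      by (simp only: powr_realpow of_nat_power of_nat_numeral)
    then have "2 * 2 ^ b \<le> n"
      by (simp only: of_nat_le_iff power_Suc)
    have "\<theta> \<ge> 0"
      using p \<theta> by auto
    have "real (b - n0) \<ge> ln (real n) / 2"
      using b log \<open>n0 < b\<close> by (simp add: of_nat_diff)
    then have "(ln (real n) / 2) powr \<theta> \<le> real (b - n0) powr \<theta>"
      using ln \<open>\<theta> \<ge> 0\<close> by (intro powr_mono2) auto
    then have "1024 * A\<^sup>2 * real n / real (b - n0) powr \<theta> \<le> 1024 * A\<^sup>2 * real n / (ln (real n) / 2) powr \<theta>"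
      using ln \<open>n0 < b\<close> by (intro divide_left_mono) auto
    also have "\<dots> = (1024 * A\<^sup>2 * 2 powr \<theta>) * norm (real n / ln (real n) powr \<theta>)"
      using ln by (simp add: powr_divide)
    finally show ?case
      using Lp_opnorm_powers_le[OF n0 \<open>n0 < b\<close> \<open>2 * 2 ^ b \<le> n\<close> \<theta>]
        Lp_opnorm_nonneg[OF powers_bounded, of n] by simp
  qed
qed

end

section \<open>The growth bound for the operator norms of the powers\<close>

theorem theorem3p7:
  fixes M :: "'a measure"
    and p p' :: real
    and T :: "('a \<Rightarrow> complex) \<Rightarrow> ('a \<Rightarrow> complex)"
  assumes "sigma_finite_measure M"
    and "1 < p"
    and "1 / p + 1 / p' = 1"
    and "Lp_bounded_operator p M T"
    and "Lp_uniformly_eventually_positive p M T"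
    and "Lp_Cesaro_bounded p M T"
  shows "(\<lambda>n. Lp_opnorm p M (T ^^ n)) \<in> O(\<lambda>n. real n / ln (real n) powr max (1 / p) (1 / p'))"
proof -
  obtain n0 where n0: "\<And>n. n0 \<le> n \<Longrightarrow> Lp_positive p M (T ^^ n)"
    using assms(5) by (auto simp: Lp_uniformly_eventually_positive_def)
  let ?S = "\<lambda>n f x. \<Sum>k<n. (T ^^ k) f x"
  have S: "Lp_bounded_operator p M (?S n)" for n
    using assms(2,4) by (intro Lp_bounded_operator_sum Lp_bounded_operator_funpow) auto
  obtain C where C: "\<And>n. n \<ge> 1 \<Longrightarrow> 1 / real n * Lp_opnorm p M (?S n) \<le> C"
    using assms(6) by (auto simp: Lp_Cesaro_bounded_def bdd_above_def)
  \<comment> \<open>The mean of length 1 shows that the Cesaro bound is nonnegative, which the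
    passage to p-th powers requires.\<close>
  have C0: "0 \<le> C"
    using C[of 1] Lp_opnorm_nonneg[OF S, of 1] by simp
  have "Lp_int p M (?S n f) \<le> (C * real n) powr p * Lp_int p M f" if f: "f \<in> Lp_space p M" for n f
  proof (cases "n = 0")
    case True
    then show ?thesis
      by (simp add: Lp_int_def)
  next
    case False
    have "Lp_norm p M (?S n f) \<le> Lp_opnorm p M (?S n) * Lp_norm p M f"
      using assms(2) f by (intro Lp_norm_operator_le[OF S]) auto
    also have "\<dots> \<le> C * real n * Lp_norm p M f"
      using C[of n] False by (intro mult_right_mono Lp_norm_nonneg) (auto simp: field_simps)
    finally show ?thesis
      using assms(2) C0 by (subst Lp_int_le_iff) auto
  qed
  then interpret Lp_eventually_positive_Cesaro p M T n0 C
    using assms n0 C0 by unfold_locales auto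
  \<comment> \<open>The maximum is therefore one of the two exponents for which the bound is already
    established.\<close>
  have "1 / p' = 1 - 1 / p"
    using assms(3) by simp
  then show ?thesis
    using Lp_opnorm_powers_bigo by (auto simp: max_def)
qed

end
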